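(* Let $q$ be a prime power and let $r\ge2$ and $n$ be even with $n=2m+r$, $m\ge0$. Then $$\frac{p_r(q,n)}{p_0(q,n)}=\frac{c_r(q,n)}{c_0(q,n)}=\frac{q^{r/2}}{\prod_{j=1}^{r}(q^j-1)}\cdot\prod_{j=1}^{r/2}\left(1-\frac{1}{q^{m+j}}\right).$$ In particular, for fixed even $n$ and even $r\ge2$, $p_r(q,n)/p_0(q,n)\sim q^{-r^2/2}$ as $q\to\infty$.
   Context: Let ${\mathbb F}_q$ be the finite field of order $q$. A differential on ${\mathbb F}_q^n$ is a linear map $D$ with $D^2=0$; its homology is $\ker D/\operatorname{im}D$. Let $c(q,n)$ be the number of differentials on ${\mathbb F}_q^n$, $c_r(q,n)$ the number with $r$-dimensional homology, and $p_r(q,n)=c_r(q,n)/c(q,n)$. *)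

theory Defs
  imports "HOL-Analysis.Analysis"
begin

text \<open>Linear maps on F_q^n are represented by n x n matrices over the finite field 'a
  (q = CARD('a), n = CARD('n)). A differential is D with D D = 0.\<close>

definition is_differential :: "'a::field^'n^'n \<Rightarrow> bool" where
  "is_differential D \<longleftrightarrow> D ** D = 0"

text \<open>Dimension of the homology ker D / im D, i.e. dim ker D - dim im D.\<close>
definition homology_dim :: "'a::field^'n^'n \<Rightarrow> nat" where
  "homology_dim D = vec.dim {x. D *v x = 0} - vec.dim (range (\<lambda>x. D *v x))"

definition c_all :: "('a::{field,finite}^'n::finite^'n) itself \<Rightarrow> nat" where
  "c_all _ = card {D :: 'a^'n^'n. is_differential D}"

definition c_hom :: "('a::{field,finite}^'n::finite^'n) itself \<Rightarrow> nat \<Rightarrow> nat" where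
  "c_hom _ r = card {D :: 'a^'n^'n. is_differential D \<and> homology_dim D = r}"

definition p_hom :: "('a::{field,finite}^'n::finite^'n) itself \<Rightarrow> nat \<Rightarrow> real" where
  "p_hom T r = real (c_hom T r) / real (c_all T)"

definition ratio_formula :: "real \<Rightarrow> nat \<Rightarrow> nat \<Rightarrow> real" where
  "ratio_formula q m r =
     q ^ (r div 2) / (\<Prod>j=1..r. q ^ j - 1) * (\<Prod>j=1..r div 2. 1 - 1 / q ^ (m + j))"

end

theory Submission
  imports Defs
begin

text \<open>A differential \<open>D\<close> of rank \<open>k\<close> on \<open>F\<^sub>q\<^sup>n\<close> has homology of dimension \<open>n - 2k\<close>. Call an
  ordered basis adapted to \<open>D\<close> if it has the form \<open>f @ D f @ g\<close> with \<open>|f| = k\<close> and \<open>D g = 0\<close>. Every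
  ordered basis is adapted to exactly one differential of rank \<open>k\<close>, and every differential of
  rank \<open>k\<close> has the same number \<open>N(k)\<close> of adapted bases, so (number of differentials of rank \<open>k\<close>)
  \<open>\<cdot> N(k) = |GL\<^sub>n(F\<^sub>q)|\<close>. Hence \<open>c\<^sub>r / c\<^sub>0 = N(m + r/2) / N(m)\<close>, and \<open>N(k)\<close> is an explicit
  power of \<open>q\<close> times \<open>q\<close>-Pochhammer symbols, which gives both the closed form and the asymptotics.\<close>

section \<open>Counting in vector spaces over a finite field\<close>

lemma card_UNIV_field_ge_2: "CARD('a::{field,finite}) \<ge> 2"
proof -
  have "card {0::'a, 1} \<le> CARD('a)" by (rule card_mono) auto
  then show ?thesis by simp
qed

lemma finite_length_lists: "finite {xs :: 'b::finite list. length xs = l \<and> P xs}"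
  by (rule finite_subset[OF _ finite_lists_length_eq[of "UNIV :: 'b set" l]]) auto

lemma bij_betw_span_insert:
  fixes x :: "'a::field^'n::finite"
  assumes x: "x \<notin> vec.span B"
  shows "bij_betw (\<lambda>(c, v). c *s x + v) (UNIV \<times> vec.span B) (vec.span (insert x B))"
    (is "bij_betw ?f _ _")
proof (rule bij_betw_imageI)
  show "inj_on ?f (UNIV \<times> vec.span B)"
  proof (rule inj_onI, clarify)
    fix c v c' v'
    assume v: "v \<in> vec.span B" "v' \<in> vec.span B" and eq: "c *s x + v = c' *s x + v'"
    have "(c - c') *s x = v' - v" using eq by (simp add: algebra_simps vector_sub_rdistrib)
    then have "(c - c') *s x \<in> vec.span B" using vec.span_diff[OF v(2,1)] by simp
    then have "c = c'"
      using x vec.span_scale[of "(c - c') *s x" B "inverse (c - c')"]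
      by (metis eq_iff_diff_eq_0 left_inverse vec.scale_one vec.scale_scale)
    then show "c = c' \<and> v = v'" using eq by simp
  qed
  show "?f ` (UNIV \<times> vec.span B) = vec.span (insert x B)"
  proof (intro equalityI subsetI)
    fix y assume "y \<in> vec.span (insert x B)"
    then obtain c where "y - c *s x \<in> vec.span B" using vec.span_insert by blast
    then show "y \<in> ?f ` (UNIV \<times> vec.span B)" by (intro image_eqI[of _ _ "(c, y - c *s x)"]) auto
  next
    fix y assume "y \<in> ?f ` (UNIV \<times> vec.span B)"
    then obtain c v where "v \<in> vec.span B" "y = c *s x + v" by auto
    then have "y - c *s x \<in> vec.span B" by simp
    then show "y \<in> vec.span (insert x B)" unfolding vec.span_insert by blast
  qed
qed

lemma card_span_independent:
  fixes B :: "('a::{field,finite}^'n::finite) set"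
  assumes "vec.independent B"
  shows "card (vec.span B) = CARD('a) ^ card B"
proof -
  have "finite B" using assms vec.finiteI_independent by blast
  then show ?thesis using assms
  proof (induction B rule: finite_induct)
    case empty
    then show ?case by simp
  next
    case (insert x B)
    have indep: "vec.independent B" using insert.prems vec.independent_mono by blast
    have "x \<notin> vec.span B" using insert.prems insert.hyps(2) by (simp add: vec.independent_insert)
    then have "card (vec.span (insert x B)) = CARD('a) * card (vec.span B)"
      using bij_betw_same_card[OF bij_betw_span_insert[of x B]] by (simp add: card_cartesian_product)
    then show ?case using insert indep by simp
  qed
qed

lemma card_subspace:
  fixes S :: "('a::{field,finite}^'n::finite) set"
  assumes "vec.subspace S"
  shows "card S = CARD('a) ^ vec.dim S"
proof -
  obtain B where "B \<subseteq> S" "vec.independent B" "S \<subseteq> vec.span B" "card B = vec.dim S"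
    using vec.basis_exists by blast
  then show ?thesis using card_span_independent assms vec.span_subspace by metis
qed

lemma card_fibre_eq_card_kernel:
  fixes A :: "'a::{field,finite}^'n::finite^'m::finite"
  assumes "y \<in> range ((*v) A)"
  shows "card {x. A *v x = y} = card {x. A *v x = 0}"
proof -
  obtain x0 where "A *v x0 = y" using assms by auto
  then have "bij_betw (\<lambda>z. x0 + z) {x. A *v x = 0} {x. A *v x = y}"
    by (intro bij_betwI[where g = "\<lambda>x. x - x0"]) (auto simp: matrix_vector_right_distrib vec.diff)
  then show ?thesis by (metis bij_betw_same_card)
qed

text \<open>Rank--nullity, proved by counting: the fibres of \<open>A\<close> partition \<open>F\<^sub>q\<^sup>n\<close> into
  translates of the kernel.\<close>

lemma dim_kernel_add_dim_range:
  fixes A :: "'a::{field,finite}^'n::finite^'m::finite"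
  shows "vec.dim {x. A *v x = 0} + vec.dim (range ((*v) A)) = CARD('n)"
proof -
  let ?K = "{x. A *v x = 0}" and ?R = "range ((*v) A)"
  have "UNIV = (\<Union>y\<in>?R. {x. A *v x = y})" by auto
  then have "CARD('a^'n) = card (\<Union>y\<in>?R. {x. A *v x = y})" by simp
  also have "\<dots> = (\<Sum>y\<in>?R. card {x. A *v x = y})" by (rule card_UN_disjoint) auto
  also have "\<dots> = card ?R * card ?K" using card_fibre_eq_card_kernel[of _ A] by simp
  also have "\<dots> = CARD('a) ^ (vec.dim ?K + vec.dim ?R)"
    by (simp add: card_subspace vec.subspace_kernel vec.subspace_image power_add)
  finally show ?thesis
    using card_UNIV_field_ge_2[where 'a = 'a] power_inject_exp[of "CARD('a)"] by simp
qed

section \<open>Independent lists and ordered bases\<close>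

definition indep_list :: "('a::field^'n) list \<Rightarrow> bool" where
  "indep_list xs \<longleftrightarrow> distinct xs \<and> vec.independent (set xs)"

lemma indep_list_snoc: "indep_list (xs @ [x]) \<longleftrightarrow> indep_list xs \<and> x \<notin> vec.span (set xs)"
  unfolding indep_list_def by (auto simp: vec.independent_insert vec.span_base)

lemma indep_list_appendD: "indep_list (xs @ ys) \<Longrightarrow> indep_list xs \<and> indep_list ys"
  unfolding indep_list_def using vec.independent_mono[of "set xs \<union> set ys"] by auto

lemma card_span_indep_list:
  fixes xs :: "('a::{field,finite}^'n::finite) list"
  shows "indep_list xs \<Longrightarrow> card (vec.span (set xs)) = CARD('a) ^ length xs"
  unfolding indep_list_def using card_span_independent distinct_card by metis

lemma bij_betw_snoc_indep_extensions:
  "bij_betw (\<lambda>(g, x). g @ [x])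
     (SIGMA g:{g. length g = l \<and> set g \<subseteq> S \<and> indep_list (A @ g)}. S - vec.span (set (A @ g)))
     {g. length g = Suc l \<and> set g \<subseteq> S \<and> indep_list (A @ g)}"
    (is "bij_betw ?m ?X ?Y")
proof (rule bij_betw_imageI)
  show "inj_on ?m ?X" by (rule inj_onI) auto
  show "?m ` ?X = ?Y"
  proof (intro equalityI subsetI)
    fix h assume h: "h \<in> ?Y"
    then obtain g x where "h = g @ [x]" by (metis (mono_tags, lifting) length_Suc_conv_rev mem_Collect_eq)
    then show "h \<in> ?m ` ?X"
      using h indep_list_snoc[of "A @ g" x] by (auto intro!: image_eqI[of _ _ "(g, x)"])
  next
    fix h assume "h \<in> ?m ` ?X"
    then obtain g x where "g \<in> {g. length g = l \<and> set g \<subseteq> S \<and> indep_list (A @ g)}"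
      "x \<in> S - vec.span (set (A @ g))" "h = g @ [x]" by auto
    then show "h \<in> ?Y" using indep_list_snoc[of "A @ g" x] by auto
  qed
qed

text \<open>Extending an independent list of vectors of \<open>S\<close> one vector at a time, the \<open>i\<close>-th new vector
  may be anything in \<open>S\<close> outside a span of size \<open>q\<^bsup>|A| + i\<^esup>\<close>.\<close>

lemma card_indep_extensions:
  fixes S :: "('a::{field,finite}^'n::finite) set"
  assumes S: "vec.subspace S" and A: "set A \<subseteq> S" "indep_list A"
  shows "card {g. length g = l \<and> set g \<subseteq> S \<and> indep_list (A @ g)}
       = (\<Prod>i<l. CARD('a) ^ vec.dim S - CARD('a) ^ (length A + i))"
proof (induction l)
  case 0
  have "{g. length g = 0 \<and> set g \<subseteq> S \<and> indep_list (A @ g)} = {[]}" using A by auto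
  then show ?case by simp
next
  case (Suc l)
  let ?G = "\<lambda>l. {g. length g = l \<and> set g \<subseteq> S \<and> indep_list (A @ g)}"
  let ?T = "\<lambda>g. S - vec.span (set (A @ g))"
  have card_T: "card (?T g) = CARD('a) ^ vec.dim S - CARD('a) ^ (length A + l)" if "g \<in> ?G l" for g
  proof -
    have "vec.span (set (A @ g)) \<subseteq> S" using that A vec.span_minimal[OF _ S] by auto
    then show ?thesis
      using that card_subspace[OF S] card_span_indep_list[of "A @ g"] by (simp add: card_Diff_subset)
  qed
  have "card (?G (Suc l)) = card (SIGMA g:?G l. ?T g)"
    using bij_betw_same_card[OF bij_betw_snoc_indep_extensions[of l S A]] by simp
  also have "\<dots> = (\<Sum>g\<in>?G l. card (?T g))"
    by (rule card_SigmaI) (auto intro: finite_length_lists)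
  also have "\<dots> = card (?G l) * (CARD('a) ^ vec.dim S - CARD('a) ^ (length A + l))"
    using card_T by simp
  finally show ?case using Suc.IH by simp
qed

definition ordered_basis :: "('a::field^'n::finite) list \<Rightarrow> bool" where
  "ordered_basis P \<longleftrightarrow> length P = CARD('n) \<and> indep_list P"

lemma card_ordered_bases:
  "card {P :: ('a::{field,finite}^'n::finite) list. ordered_basis P}
     = (\<Prod>i<CARD('n). CARD('a) ^ CARD('n) - CARD('a) ^ i)"
proof -
  have "card {g :: ('a^'n) list. length g = CARD('n) \<and> set g \<subseteq> UNIV \<and> indep_list ([] @ g)}
      = (\<Prod>i<CARD('n). CARD('a) ^ vec.dim (UNIV :: ('a^'n) set) - CARD('a) ^ (length ([] :: ('a^'n) list) + i))"
    by (rule card_indep_extensions) (auto simp: indep_list_def vec.independent_empty)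
  then show ?thesis by (simp add: ordered_basis_def card_cart_basis)
qed

lemma span_ordered_basis:
  fixes P :: "('a::{field,finite}^'n::finite) list"
  assumes "ordered_basis P"
  shows "vec.span (set P) = UNIV"
proof -
  have "card (set P) = CARD('n)"
    using assms by (simp add: ordered_basis_def indep_list_def distinct_card)
  then show ?thesis
    using assms vec.card_ge_dim_independent[of "set P" UNIV]
    by (auto simp: ordered_basis_def indep_list_def card_cart_basis)
qed

lemma ordered_basis_if_spanning:
  fixes P :: "('a::{field,finite}^'n::finite) list"
  assumes len: "length P = CARD('n)" and span: "UNIV \<subseteq> vec.span (set P)"
  shows "ordered_basis P"
proof -
  have "card (set P) \<le> CARD('n)" using card_length[of P] len by simp
  then have "vec.independent (set P)"
    using vec.card_le_dim_spanning[of "set P" UNIV] span by (auto simp: card_cart_basis)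
  moreover have "CARD('n) \<le> card (set P)"
    using vec.span_card_ge_dim[of "set P" UNIV] span by (auto simp: card_cart_basis)
  then have "distinct P" using card_length[of P] len card_distinct by (metis antisym)
  ultimately show ?thesis using len by (simp add: ordered_basis_def indep_list_def)
qed

lemma ex1_matrix_on_ordered_basis:
  fixes P :: "('a::{field,finite}^'n::finite) list" and v :: "nat \<Rightarrow> 'a^'m::finite"
  assumes P: "ordered_basis P"
  shows "\<exists>!A. \<forall>i<CARD('n). A *v P ! i = v i"
proof (rule ex_ex1I)
  have indep: "vec.independent (set P)" and inj: "inj_on ((!) P) {..<CARD('n)}"
    using P by (auto simp: ordered_basis_def indep_list_def intro: inj_on_nth)
  let ?L = "vec.construct (set P) (\<lambda>x. v (inv_into {..<CARD('n)} ((!) P) x))"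
  have "matrix ?L *v P ! i = v i" if "i < CARD('n)" for i
    using that P inv_into_f_f[OF inj]
    by (simp add: matrix_works vec.linear_construct[OF indep] vec.construct_basis[OF indep] ordered_basis_def)
  then show "\<exists>A. \<forall>i<CARD('n). A *v P ! i = v i" by blast
next
  fix A B :: "'a^'n^'m"
  assume "\<forall>i<CARD('n). A *v P ! i = v i" "\<forall>i<CARD('n). B *v P ! i = v i"
  then have "A *v x = B *v x" if "x \<in> set P" for x
    using that P by (auto simp: in_set_conv_nth ordered_basis_def)
  then have "A *v x = B *v x" for x
    using vec.linear_eq_on[OF matrix_vector_mul_linear_gen matrix_vector_mul_linear_gen, of x "set P"]
      span_ordered_basis[OF P] by auto
  then show "A = B" by (simp add: matrix_eq)
qed

section \<open>Differentials and adapted bases\<close>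

abbreviation col_rank :: "'a::field^'n^'m \<Rightarrow> nat" where
  "col_rank A \<equiv> vec.dim (range ((*v) A))"

lemma sq_zero_mult_vec_twice: "D ** D = 0 \<Longrightarrow> D *v (D *v x) = 0"
  by (simp add: matrix_vector_mul_assoc)

lemma sq_zero_double_col_rank_le:
  fixes D :: "'a::{field,finite}^'n::finite^'n"
  assumes "D ** D = 0"
  shows "2 * col_rank D \<le> CARD('n)"
proof -
  have "range ((*v) D) \<subseteq> {x. D *v x = 0}" using sq_zero_mult_vec_twice[OF assms] by auto
  then have "col_rank D \<le> vec.dim {x. D *v x = 0}" by (rule vec.dim_subset)
  then show ?thesis using dim_kernel_add_dim_range[of D] by simp
qed

lemma c_hom_eq_card_col_rank:
  fixes T :: "('a::{field,finite}^'n::finite^'n) itself"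
  assumes "2 * k + r = CARD('n)"
  shows "c_hom T r = card {D :: 'a^'n^'n. D ** D = 0 \<and> col_rank D = k}"
proof -
  have "homology_dim D = CARD('n) - 2 * col_rank D" for D :: "'a^'n^'n"
    using dim_kernel_add_dim_range[of D] unfolding homology_dim_def by simp
  then have "is_differential D \<and> homology_dim D = r \<longleftrightarrow> D ** D = 0 \<and> col_rank D = k"
    for D :: "'a^'n^'n"
    using assms sq_zero_double_col_rank_le[of D] unfolding is_differential_def by auto
  then show ?thesis unfolding c_hom_def by simp
qed

text \<open>An adapted basis for \<open>D\<close> has the shape \<open>f @ D f @ g\<close> with \<open>|f| = k\<close> and \<open>D g = 0\<close>; in it
  \<open>D\<close> is the block matrix with a single identity block of size \<open>k\<close>.\<close>

definition adapted :: "nat \<Rightarrow> 'a::field^'n^'n \<Rightarrow> ('a^'n) list \<Rightarrow> bool" where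
  "adapted k D P \<longleftrightarrow> (\<forall>i<length P. D *v P ! i = (if i < k then P ! (k + i) else 0))"

lemma adapted_append_iff:
  assumes "length f = k"
  shows "adapted k D (f @ map ((*v) D) f @ g) \<longleftrightarrow> (\<forall>x\<in>set (map ((*v) D) f @ g). D *v x = 0)"
proof -
  let ?E = "map ((*v) D) f @ g"
  have "adapted k D (f @ ?E) \<longleftrightarrow> (\<forall>i<k + length ?E. k \<le> i \<longrightarrow> D *v ?E ! (i - k) = 0)"
    unfolding adapted_def using assms by (auto simp: nth_append)
  also have "\<dots> \<longleftrightarrow> (\<forall>j<length ?E. D *v ?E ! j = 0)"
    by (auto dest: spec[of _ "_ + k"])
  finally show ?thesis by (simp only: all_set_conv_all_nth)
qed

lemma adapted_decompose:
  assumes "adapted k D P" and "2 * k \<le> length P"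
  shows "P = take k P @ map ((*v) D) (take k P) @ drop (2 * k) P"
proof (rule nth_equalityI)
  fix i assume "i < length P"
  then show "P ! i = (take k P @ map ((*v) D) (take k P) @ drop (2 * k) P) ! i"
    using assms by (auto simp: adapted_def nth_append)
qed (use assms in simp)

lemma ex1_adapted:
  fixes P :: "('a::{field,finite}^'n::finite) list"
  assumes "ordered_basis P"
  shows "\<exists>!D. adapted k D P"
  using ex1_matrix_on_ordered_basis[OF assms, of "\<lambda>i. if i < k then P ! (k + i) else 0"] assms
  by (simp add: adapted_def ordered_basis_def)

lemma adapted_sq_zero:
  fixes D :: "'a::{field,finite}^'n::finite^'n"
  assumes P: "ordered_basis P" and k: "2 * k \<le> CARD('n)" and D: "adapted k D P"
  shows "D ** D = 0"
proof -
  have len: "length P = CARD('n)" using P by (simp add: ordered_basis_def)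
  have DP: "D *v P ! i = (if i < k then P ! (k + i) else 0)" if "i < CARD('n)" for i
    using D that len by (simp add: adapted_def)
  have "\<forall>i<CARD('n). (D ** D) *v P ! i = 0"
    using DP k by (simp add: matrix_vector_mul_assoc[symmetric])
  moreover have "\<forall>i<CARD('n). (0 :: 'a^'n^'n) *v P ! i = 0" by simp
  ultimately show ?thesis using ex1_matrix_on_ordered_basis[OF P, of "\<lambda>_. 0"] by blast
qed

lemma adapted_col_rank:
  fixes D :: "'a::{field,finite}^'n::finite^'n"
  assumes P: "ordered_basis P" and k: "2 * k \<le> CARD('n)" and D: "adapted k D P"
  shows "col_rank D = k"
proof -
  let ?T = "take k (drop k P)"
  have len: "length P = CARD('n)" using P by (simp add: ordered_basis_def)
  have DP: "D *v P ! i = (if i < k then P ! (k + i) else 0)" if "i < CARD('n)" for i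
    using D that len by (simp add: adapted_def)
  have "set ?T \<subseteq> (*v) D ` set P"
  proof
    fix y assume "y \<in> set ?T"
    then obtain j where "j < k" "y = P ! (k + j)" using len k by (auto simp: in_set_conv_nth)
    then show "y \<in> (*v) D ` set P" using DP[of j] k len by (auto intro!: image_eqI[of _ _ "P ! j"])
  qed
  moreover have "(*v) D ` set P \<subseteq> insert 0 (set ?T)"
  proof
    fix y assume "y \<in> (*v) D ` set P"
    then obtain i where "i < CARD('n)" "y = D *v P ! i" using len by (auto simp: in_set_conv_nth)
    then show "y \<in> insert 0 (set ?T)"
      using DP k len by (auto simp: in_set_conv_nth intro!: exI[of _ i])
  qed
  ultimately have "vec.span (set ?T) \<subseteq> vec.span ((*v) D ` set P)"
    and "vec.span ((*v) D ` set P) \<subseteq> vec.span (set ?T)"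
    using vec.span_mono vec.span_insert_0 by metis+
  moreover have "range ((*v) D) = (*v) D ` vec.span (set P)" using span_ordered_basis[OF P] by simp
  then have "range ((*v) D) = vec.span ((*v) D ` set P)" by (simp add: vec.span_image)
  ultimately have "range ((*v) D) = vec.span (set ?T)" by simp
  moreover have "indep_list ?T"
  proof -
    have "indep_list (drop k P)"
      using P indep_list_appendD[of "take k P" "drop k P"] by (simp add: ordered_basis_def)
    then show ?thesis
      using indep_list_appendD[of ?T "drop k (drop k P)"] by (simp only: append_take_drop_id)
  qed
  ultimately show ?thesis
    using len k by (simp add: indep_list_def vec.dim_span vec.dim_eq_card_independent distinct_card)
qed

lemma adapted_basis_split:
  fixes D :: "'a::{field,finite}^'n::finite^'n"
  assumes P: "ordered_basis P" "adapted k D P" and kn: "2 * k \<le> CARD('n)"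
  obtains f g where "P = f @ map ((*v) D) f @ g"
    and "length f = k" "indep_list (map ((*v) D) f)"
    and "length g = CARD('n) - 2 * k" "set g \<subseteq> {x. D *v x = 0}" "indep_list (map ((*v) D) f @ g)"
proof -
  have len: "length P = CARD('n)" using P(1) by (simp add: ordered_basis_def)
  define f where "f = take k P"
  define g where "g = drop (2 * k) P"
  have P_eq: "P = f @ map ((*v) D) f @ g"
    unfolding f_def g_def by (rule adapted_decompose[OF P(2)]) (simp add: len kn)
  have f: "length f = k" using len kn by (simp add: f_def)
  have "indep_list (f @ map ((*v) D) f @ g)" using P(1) P_eq by (simp add: ordered_basis_def)
  then have indep: "indep_list (map ((*v) D) f @ g)"
    using indep_list_appendD[of f "map ((*v) D) f @ g"] by blast
  have "adapted k D (f @ map ((*v) D) f @ g)" using P(2) P_eq by simp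
  then have "set g \<subseteq> {x. D *v x = 0}" using adapted_append_iff[OF f] by auto
  moreover have "length g = CARD('n) - 2 * k" using len by (simp add: g_def)
  moreover have "indep_list (map ((*v) D) f)" using indep indep_list_appendD by blast
  ultimately show ?thesis using that P_eq f indep by blast
qed

section \<open>Counting adapted bases\<close>

lemma card_preimage_lists:
  fixes A :: "'a::{field,finite}^'n::finite^'m::finite"
  assumes "set ys \<subseteq> range ((*v) A)"
  shows "card {xs. map ((*v) A) xs = ys} = card {x. A *v x = 0} ^ length ys"
  using assms
proof (induction ys)
  case Nil
  then show ?case by simp
next
  case (Cons y ys)
  have "{xs. map ((*v) A) xs = y # ys}
      = (\<lambda>(x, xs). x # xs) ` ({x. A *v x = y} \<times> {xs. map ((*v) A) xs = ys})"
    by (auto simp: Cons_eq_map_conv)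
  moreover have "inj_on (\<lambda>(x, xs). x # xs) ({x. A *v x = y} \<times> {xs. map ((*v) A) xs = ys})"
    by (rule inj_onI) auto
  ultimately have "card {xs. map ((*v) A) xs = y # ys}
      = card {x. A *v x = y} * card {xs. map ((*v) A) xs = ys}"
    by (simp add: card_image card_cartesian_product)
  then show ?case using Cons card_fibre_eq_card_kernel[of y A] by simp
qed

text \<open>Choose the images \<open>D f\<close> as an ordered basis of the range, then each \<open>f\<^sub>i\<close> in a fibre of
  size \<open>q\<^bsup>n - k\<^esup>\<close>.\<close>

lemma card_indep_image_lists:
  fixes D :: "'a::{field,finite}^'n::finite^'m::finite"
  assumes k: "col_rank D = k"
  shows "card {f. length f = k \<and> indep_list (map ((*v) D) f)}
       = CARD('a) ^ ((CARD('n) - k) * k) * (\<Prod>i<k. CARD('a) ^ k - CARD('a) ^ i)"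
proof -
  let ?Y = "{ys. length ys = k \<and> set ys \<subseteq> range ((*v) D) \<and> indep_list ([] @ ys)}"
  have card_Y: "card ?Y = (\<Prod>i<k. CARD('a) ^ k - CARD('a) ^ i)"
    using card_indep_extensions[OF vec.subspace_image[OF vec.subspace_UNIV], of "[]" D k] k
    by (simp add: indep_list_def vec.independent_empty)
  have dim_kernel: "vec.dim {x. D *v x = 0} = CARD('n) - k"
    using dim_kernel_add_dim_range[of D] k by simp
  have fin: "finite {f. map ((*v) D) f = ys}" for ys
    by (rule finite_subset[OF _ finite_length_lists[of "length ys" "\<lambda>_. True"]]) auto
  have "card {f. length f = k \<and> indep_list (map ((*v) D) f)}
      = card (\<Union>ys\<in>?Y. {f. map ((*v) D) f = ys})"
    by (rule arg_cong[where f = card]) auto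
  also have "\<dots> = (\<Sum>ys\<in>?Y. card {f. map ((*v) D) f = ys})"
    using fin by (intro card_UN_disjoint) (auto intro: finite_length_lists)
  also have "\<dots> = (\<Sum>ys\<in>?Y. CARD('a) ^ ((CARD('n) - k) * k))"
    by (rule sum.cong) (auto simp: card_preimage_lists card_subspace vec.subspace_kernel dim_kernel
        power_mult)
  finally show ?thesis using card_Y by simp
qed

text \<open>If \<open>D f\<close> spans the range and \<open>D f @ g\<close> is a basis of the kernel, then every \<open>v\<close> differs from
  a combination of \<open>f\<close> by a vector of the kernel, so \<open>f @ D f @ g\<close> spans.\<close>

lemma ordered_basis_append_image:
  fixes D :: "'a::{field,finite}^'n::finite^'n"
  assumes sq: "D ** D = 0" and k: "col_rank D = k" and f: "length f = k"
    and g: "length g = CARD('n) - 2 * k" "set g \<subseteq> {x. D *v x = 0}"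
      "indep_list (map ((*v) D) f @ g)"
  shows "ordered_basis (f @ map ((*v) D) f @ g)"
proof -
  let ?E = "map ((*v) D) f @ g" and ?K = "{x. D *v x = 0}"
  let ?P = "f @ ?E"
  have kn: "2 * k \<le> CARD('n)" using sq_zero_double_col_rank_le[OF sq] k by simp
  have dim_K: "vec.dim ?K = CARD('n) - k" using dim_kernel_add_dim_range[of D] k by simp
  have indep_E: "vec.independent (set ?E)" and distinct_E: "distinct ?E"
    using g(3) unfolding indep_list_def by auto
  have indep_Df: "vec.independent (set (map ((*v) D) f))" and distinct_Df: "distinct (map ((*v) D) f)"
    using indep_list_appendD[OF g(3)] unfolding indep_list_def by auto
  have "set ?E \<subseteq> ?K" using g(2) sq_zero_mult_vec_twice[OF sq] by auto
  moreover have "vec.dim ?K \<le> card (set ?E)"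
    using distinct_card[OF distinct_E] f g(1) kn dim_K by simp
  ultimately have K: "?K \<subseteq> vec.span (set ?E)"
    by (rule vec.card_ge_dim_independent[OF _ indep_E])
  have "set (map ((*v) D) f) \<subseteq> range ((*v) D)" by auto
  moreover have "col_rank D \<le> card (set (map ((*v) D) f))"
    using distinct_card[OF distinct_Df] f k by simp
  ultimately have R: "range ((*v) D) \<subseteq> vec.span (set (map ((*v) D) f))"
    by (rule vec.card_ge_dim_independent[OF _ indep_Df])
  have "v \<in> vec.span (set ?P)" for v
  proof -
    have "D *v v \<in> vec.span ((*v) D ` set f)" using R by auto
    then have "D *v v \<in> (*v) D ` vec.span (set f)" by (simp add: vec.span_image)
    then obtain w where w: "w \<in> vec.span (set f)" "D *v w = D *v v" by auto
    have "D *v (v - w) = 0" using w(2) by (simp add: vec.diff)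
    then have "v - w \<in> vec.span (set ?E)" using K by auto
    then have vw: "v - w \<in> vec.span (set ?P)" using vec.span_mono[of "set ?E" "set ?P"] by auto
    have "w \<in> vec.span (set ?P)" using w(1) vec.span_mono[of "set f" "set ?P"] by auto
    from this vw have "w + (v - w) \<in> vec.span (set ?P)" by (rule vec.span_add)
    then show ?thesis by simp
  qed
  then show ?thesis using f g(1) kn by (intro ordered_basis_if_spanning) auto
qed

lemma bij_betw_adapted_bases:
  fixes D :: "'a::{field,finite}^'n::finite^'n"
  assumes sq: "D ** D = 0" and k: "col_rank D = k"
  shows "bij_betw (\<lambda>(f, g). f @ map ((*v) D) f @ g)
           (SIGMA f:{f. length f = k \<and> indep_list (map ((*v) D) f)}.
              {g. length g = CARD('n) - 2 * k \<and> set g \<subseteq> {x. D *v x = 0}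
                  \<and> indep_list (map ((*v) D) f @ g)})
           {P. ordered_basis P \<and> adapted k D P}"
    (is "bij_betw ?m ?S ?B")
proof (rule bij_betw_imageI)
  have kn: "2 * k \<le> CARD('n)" using sq_zero_double_col_rank_le[OF sq] k by simp
  show "inj_on ?m ?S"
  proof (rule inj_onI)
    fix x y assume x: "x \<in> ?S" and y: "y \<in> ?S" and eq: "?m x = ?m y"
    obtain f g f' g' where xy: "x = (f, g)" "y = (f', g')" by fastforce
    have "length f = length f'" using x y unfolding xy by simp
    moreover have "f @ map ((*v) D) f @ g = f' @ map ((*v) D) f' @ g'" using eq unfolding xy by simp
    ultimately show "x = y" unfolding xy by (simp add: append_eq_append_conv)
  qed
  show "?m ` ?S = ?B"
  proof (intro equalityI subsetI)
    fix P assume "P \<in> ?B"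
    then have "ordered_basis P" "adapted k D P" by auto
    then obtain f g where "P = f @ map ((*v) D) f @ g"
      and "length f = k" "indep_list (map ((*v) D) f)"
      and "length g = CARD('n) - 2 * k" "set g \<subseteq> {x. D *v x = 0}" "indep_list (map ((*v) D) f @ g)"
      using kn by (rule adapted_basis_split)
    then show "P \<in> ?m ` ?S" by (intro image_eqI[of _ _ "(f, g)"]) auto
  next
    fix P assume "P \<in> ?m ` ?S"
    then obtain f g where f: "length f = k" "indep_list (map ((*v) D) f)"
      and g: "length g = CARD('n) - 2 * k" "set g \<subseteq> {x. D *v x = 0}"
        "indep_list (map ((*v) D) f @ g)"
      and P_eq: "P = f @ map ((*v) D) f @ g" by auto
    have "ordered_basis P" unfolding P_eq by (rule ordered_basis_append_image[OF sq k f(1) g])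
    moreover have "\<forall>x\<in>set (map ((*v) D) f @ g). D *v x = 0"
      using g(2) sq_zero_mult_vec_twice[OF sq] by auto
    then have "adapted k D P" unfolding P_eq using adapted_append_iff[OF f(1)] by blast
    ultimately show "P \<in> ?B" by simp
  qed
qed

definition adapted_count :: "nat \<Rightarrow> nat \<Rightarrow> nat \<Rightarrow> nat" where
  "adapted_count q n k =
     q ^ ((n - k) * k) * (\<Prod>i<k. q ^ k - q ^ i) * (\<Prod>i<n - 2 * k. q ^ (n - k) - q ^ (k + i))"

lemma card_adapted_bases:
  fixes D :: "'a::{field,finite}^'n::finite^'n"
  assumes sq: "D ** D = 0" and k: "col_rank D = k"
  shows "card {P. ordered_basis P \<and> adapted k D P} = adapted_count CARD('a) CARD('n) k"
proof -
  let ?F = "{f. length f = k \<and> indep_list (map ((*v) D) f)}"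
  let ?G = "\<lambda>f. {g. length g = CARD('n) - 2 * k \<and> set g \<subseteq> {x. D *v x = 0}
                  \<and> indep_list (map ((*v) D) f @ g)}"
  have "card (?G f) = (\<Prod>i<CARD('n) - 2 * k. CARD('a) ^ (CARD('n) - k) - CARD('a) ^ (k + i))"
    if "f \<in> ?F" for f
  proof -
    have "set (map ((*v) D) f) \<subseteq> {x. D *v x = 0}" using sq_zero_mult_vec_twice[OF sq] by auto
    moreover have "vec.dim {x. D *v x = 0} = CARD('n) - k"
      using dim_kernel_add_dim_range[of D] k by simp
    ultimately show ?thesis
      using that card_indep_extensions[OF vec.subspace_kernel[of D], of "map ((*v) D) f"] by simp
  qed
  then have "(\<Sum>f\<in>?F. card (?G f))
      = card ?F * (\<Prod>i<CARD('n) - 2 * k. CARD('a) ^ (CARD('n) - k) - CARD('a) ^ (k + i))"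
    by simp
  moreover have "card {P. ordered_basis P \<and> adapted k D P} = (\<Sum>f\<in>?F. card (?G f))"
    using bij_betw_same_card[OF bij_betw_adapted_bases[OF sq k]]
    by (simp add: card_SigmaI finite_length_lists)
  ultimately show ?thesis using card_indep_image_lists[OF k] by (simp add: adapted_count_def)
qed

lemma card_sq_zero_col_rank_mult_adapted_count:
  assumes "2 * k \<le> CARD('n::finite)"
  shows "card {D :: 'a::{field,finite}^'n^'n. D ** D = 0 \<and> col_rank D = k}
           * adapted_count CARD('a) CARD('n) k
       = (\<Prod>i<CARD('n). CARD('a) ^ CARD('n) - CARD('a) ^ i)"
proof -
  let ?C = "{D :: 'a^'n^'n. D ** D = 0 \<and> col_rank D = k}"
  let ?B = "\<lambda>D :: 'a^'n^'n. {P. ordered_basis P \<and> adapted k D P}"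
  have "bij_betw snd (SIGMA D:?C. ?B D) {P. ordered_basis P}"
  proof (rule bij_betw_imageI)
    have "D = D'" if "ordered_basis P" "adapted k D P" "adapted k D' P" for D D' :: "'a^'n^'n" and P
      using ex1_adapted[OF that(1)] that(2,3) by blast
    then show "inj_on snd (SIGMA D:?C. ?B D)" by (intro inj_onI) auto
    show "snd ` (SIGMA D:?C. ?B D) = {P. ordered_basis P}"
    proof (intro equalityI subsetI)
      fix P :: "('a^'n) list" assume "P \<in> {P. ordered_basis P}"
      then obtain D where "ordered_basis P" "adapted k D P" using ex1_adapted by blast
      then show "P \<in> snd ` (SIGMA D:?C. ?B D)"
        using adapted_sq_zero adapted_col_rank assms by (auto intro!: image_eqI[of _ _ "(D, P)"])
    qed auto
  qed
  moreover have "finite (?B D)" for D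
    by (rule finite_subset[OF _ finite_length_lists[of "CARD('n)" "\<lambda>_. True"]])
      (auto simp: ordered_basis_def)
  ultimately have "card {P :: ('a^'n) list. ordered_basis P} = (\<Sum>D\<in>?C. card (?B D))"
    by (simp add: bij_betw_same_card[symmetric] card_SigmaI)
  also have "\<dots> = (\<Sum>D\<in>?C. adapted_count CARD('a) CARD('n) k)"
    by (rule sum.cong) (auto simp: card_adapted_bases)
  also have "\<dots> = card ?C * adapted_count CARD('a) CARD('n) k" by simp
  finally show ?thesis using card_ordered_bases[where 'a = 'a and 'n = 'n] by simp
qed

section \<open>Evaluating the count\<close>

lemma of_nat_prod_pow_diff:
  assumes "\<And>i. i \<in> I \<Longrightarrow> b i \<le> a i" and "1 \<le> q"
  shows "real (\<Prod>i\<in>I. q ^ a i - q ^ b i) = (\<Prod>i\<in>I. real q ^ a i - real q ^ b i)"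
  unfolding of_nat_prod using assms by (intro prod.cong) (simp_all add: of_nat_diff power_increasing)

text \<open>\<open>qpoch_inv q t\<close> is the \<open>q\<close>-Pochhammer symbol \<open>(1/q; 1/q)\<^sub>t\<close>.\<close>

definition qpoch_inv :: "real \<Rightarrow> nat \<Rightarrow> real" where
  "qpoch_inv q t = (\<Prod>j=1..t. 1 - 1 / q ^ j)"

lemma qpoch_inv_0 [simp]: "qpoch_inv q 0 = 1"
  by (simp add: qpoch_inv_def)

lemma qpoch_inv_Suc: "qpoch_inv q (Suc t) = qpoch_inv q t * (1 - 1 / q ^ Suc t)"
  by (simp add: qpoch_inv_def)

lemma qpoch_inv_add: "qpoch_inv q (t + s) = qpoch_inv q t * (\<Prod>j=1..s. 1 - 1 / q ^ (t + j))"
  by (induction s) (simp_all add: qpoch_inv_Suc)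

lemma qpoch_inv_pos: "1 < q \<Longrightarrow> 0 < qpoch_inv q t"
  unfolding qpoch_inv_def by (intro prod_pos) (simp add: divide_less_eq)

lemma prod_pow_diff_eq_qpoch_inv:
  fixes q :: real
  assumes "q \<noteq> 0"
  shows "(\<Prod>i<k. q ^ k - q ^ i) = q ^ (k * k) * qpoch_inv q k"
proof (induction k)
  case 0
  then show ?case by (simp add: qpoch_inv_def)
next
  case (Suc k)
  have "(\<Prod>i<Suc k. q ^ Suc k - q ^ i) = (q ^ Suc k - 1) * (\<Prod>i<k. q * (q ^ k - q ^ i))"
    by (simp add: prod.lessThan_Suc_shift algebra_simps del: prod.lessThan_Suc)
  also have "\<dots> = (q ^ Suc k - 1) * q ^ k * (q ^ (k * k) * qpoch_inv q k)"
    by (simp add: prod.distrib Suc.IH)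
  also have "\<dots> = q ^ (Suc k * Suc k) * qpoch_inv q (Suc k)"
    using assms by (simp add: qpoch_inv_Suc field_simps power_add)
  finally show ?case .
qed

lemma prod_pow_minus_one_eq_qpoch_inv:
  fixes q :: real
  assumes "q \<noteq> 0"
  shows "(\<Prod>j=1..t. q ^ j - 1) = q ^ (\<Sum>j=1..t. j) * qpoch_inv q t"
proof -
  have "(\<Prod>j=1..t. q ^ j - 1) = (\<Prod>j=1..t. q ^ j * (1 - 1 / q ^ j))"
    using assms by (intro prod.cong) (simp_all add: field_simps)
  then show ?thesis by (simp add: prod.distrib power_sum qpoch_inv_def)
qed

lemma adapted_count_eq:
  assumes "1 \<le> q" and "2 * k \<le> n"
  shows "real (adapted_count q n k)
       = real q ^ (n * k + (n - k) * (n - 2 * k)) * qpoch_inv (real q) k * qpoch_inv (real q) (n - 2 * k)"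
proof -
  obtain l where n: "n = 2 * k + l" using assms(2) by (metis le_add_diff_inverse)
  then have nk: "n - k = k + l" "n - 2 * k = l" by simp_all
  let ?q = "real q"
  have q: "?q \<noteq> 0" using assms(1) by simp
  have "(\<Prod>i<l. ?q ^ (k + l) - ?q ^ (k + i)) = (\<Prod>i<l. ?q ^ k * (?q ^ l - ?q ^ i))"
    by (simp add: power_add algebra_simps)
  also have "\<dots> = ?q ^ (k * l) * (?q ^ (l * l) * qpoch_inv ?q l)"
    by (simp add: prod.distrib power_mult prod_pow_diff_eq_qpoch_inv[OF q])
  finally have "real (\<Prod>i<l. q ^ (k + l) - q ^ (k + i)) = ?q ^ (k * l) * ?q ^ (l * l) * qpoch_inv ?q l"
    using assms(1) of_nat_prod_pow_diff[of "{..<l}" "\<lambda>i. k + i" "\<lambda>_. k + l" q] by simp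
  moreover have "real (\<Prod>i<k. q ^ k - q ^ i) = ?q ^ (k * k) * qpoch_inv ?q k"
    using assms(1) of_nat_prod_pow_diff[of "{..<k}" "\<lambda>i. i" "\<lambda>_. k" q]
    by (simp add: prod_pow_diff_eq_qpoch_inv[OF q])
  moreover have "n * k + (n - k) * (n - 2 * k) = (k + l) * k + k * k + k * l + l * l"
    unfolding nk n by (simp add: algebra_simps)
  ultimately show ?thesis unfolding adapted_count_def nk by (simp add: power_add)
qed

lemma adapted_count_ratio:
  assumes "2 \<le> q"
  shows "real (adapted_count q (2 * m + 2 * s) (m + s)) / real (adapted_count q (2 * m + 2 * s) m)
       = (\<Prod>j=1..s. 1 - 1 / real q ^ (m + j)) / (real q ^ (2 * s * s) * qpoch_inv (real q) (2 * s))"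
proof -
  let ?q = "real q" and ?E = "2 * (m + s) * (m + s)"
  have "real (adapted_count q (2 * m + 2 * s) (m + s))
      = ?q ^ ?E * qpoch_inv ?q m * (\<Prod>j=1..s. 1 - 1 / ?q ^ (m + j))"
    using assms adapted_count_eq[of q "m + s" "2 * m + 2 * s"]
    by (simp add: qpoch_inv_add algebra_simps)
  moreover have "real (adapted_count q (2 * m + 2 * s) m)
      = ?q ^ ?E * qpoch_inv ?q m * (?q ^ (2 * s * s) * qpoch_inv ?q (2 * s))"
  proof -
    have "(2 * m + 2 * s) * m + (m + 2 * s) * (2 * s) = ?E + 2 * s * s" by algebra
    then show ?thesis using assms adapted_count_eq[of q m "2 * m + 2 * s"] by (simp add: power_add)
  qed
  moreover have "?q ^ ?E * qpoch_inv ?q m \<noteq> 0" using assms qpoch_inv_pos[of ?q m] by simp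
  ultimately show ?thesis using assms by simp
qed

lemma ratio_formula_even:
  assumes "q \<noteq> 0"
  shows "ratio_formula q m (2 * s)
       = (\<Prod>j=1..s. 1 - 1 / q ^ (m + j)) / (q ^ (2 * s * s) * qpoch_inv q (2 * s))"
proof -
  have "2 * (\<Sum>j=1..2 * s. j) = 2 * (s + 2 * s * s)"
    using double_gauss_sum_from_Suc_0[of "2 * s", where 'a = nat] by (simp add: algebra_simps)
  then have "(\<Sum>j=1..2 * s. j) = s + 2 * s * s" by simp
  then have "(\<Prod>j=1..2 * s. q ^ j - 1) = q ^ s * q ^ (2 * s * s) * qpoch_inv q (2 * s)"
    using prod_pow_minus_one_eq_qpoch_inv[OF assms, of "2 * s"] by (simp add: power_add)
  then show ?thesis using assms by (simp add: ratio_formula_def)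
qed

section \<open>Asymptotics and the main theorem\<close>

lemma tendsto_prod_one_minus_inverse_powers:
  assumes "\<And>j. j \<in> J \<Longrightarrow> 0 < e j"
  shows "((\<lambda>q::nat. \<Prod>j\<in>J. 1 - 1 / real q ^ e j) \<longlongrightarrow> 1) at_top"
proof -
  have "((\<lambda>q::nat. 1 - (1 / real q) ^ e j) \<longlongrightarrow> 1 - 0 ^ e j) at_top" for j
    by (intro tendsto_intros lim_1_over_n)
  then have "((\<lambda>q::nat. \<Prod>j\<in>J. 1 - (1 / real q) ^ e j) \<longlongrightarrow> (\<Prod>j\<in>J. 1 - 0 ^ e j)) at_top"
    by (rule tendsto_prod)
  moreover have "(\<Prod>j\<in>J. 1 - 0 ^ e j) = (1 :: real)" using assms by (intro prod.neutral) simp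
  ultimately show ?thesis by (simp add: power_one_over)
qed

lemma ratio_formula_asymp_equiv:
  assumes "even r"
  shows "(\<lambda>q::nat. ratio_formula (real q) m r) \<sim>[at_top] (\<lambda>q. 1 / real q ^ (r\<^sup>2 div 2))"
proof (rule asymp_equivI')
  obtain s where r: "r = 2 * s" using assms by blast
  have "eventually (\<lambda>q::nat. ratio_formula (real q) m r / (1 / real q ^ (r\<^sup>2 div 2))
      = (\<Prod>j=1..s. 1 - 1 / real q ^ (m + j)) / qpoch_inv (real q) (2 * s)) at_top"
    using eventually_gt_at_top[of 0]
    by eventually_elim (simp add: r ratio_formula_even power2_eq_square mult.assoc)
  moreover have "((\<lambda>q::nat. (\<Prod>j=1..s. 1 - 1 / real q ^ (m + j)) / qpoch_inv (real q) (2 * s))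
      \<longlongrightarrow> 1 / 1) at_top"
    unfolding qpoch_inv_def by (intro tendsto_divide tendsto_prod_one_minus_inverse_powers) auto
  ultimately show "((\<lambda>q. ratio_formula (real q) m r / (1 / real q ^ (r\<^sup>2 div 2))) \<longlongrightarrow> 1) at_top"
    by (simp add: tendsto_cong)
qed

lemma divide_eq_divide_if_mult_eq:
  fixes a b a' b' c :: "'a::field"
  assumes "a * b = c" and "a' * b' = c" and "c \<noteq> 0"
  shows "a / a' = b' / b"
proof -
  have "a' \<noteq> 0" "b \<noteq> 0" using assms by auto
  then show ?thesis using assms by (simp add: frac_eq_eq mult.commute)
qed

lemma ratio_p_hom_eq_ratio_c_hom:
  "p_hom (T :: ('a::{field,finite}^'n::finite^'n) itself) r / p_hom T r'
     = real (c_hom T r) / real (c_hom T r')"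
proof -
  have "(0 :: 'a^'n^'n) \<in> {D. is_differential D}" by (simp add: is_differential_def)
  then have "c_all T > 0" unfolding c_all_def by (auto simp: card_gt_0_iff)
  then show ?thesis by (simp add: p_hom_def)
qed

theorem mainTheorem6:
  fixes T :: "('a::{field,finite}^'n::finite^'n) itself" and m r :: nat
  assumes "even r" and "r \<ge> 2" and "CARD('n) = 2 * m + r"
  shows "p_hom T r / p_hom T 0 = real (c_hom T r) / real (c_hom T 0)
       \<and> real (c_hom T r) / real (c_hom T 0) = ratio_formula (real CARD('a)) m r
       \<and> (\<lambda>q::nat. ratio_formula (real q) m r) \<sim>[at_top] (\<lambda>q. 1 / real q ^ (r\<^sup>2 div 2))"
proof -
  obtain s where r: "r = 2 * s" using assms(1) by blast
  let ?q = "CARD('a)" and ?n = "CARD('n)"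
  let ?C = "\<lambda>k. real (card {D :: 'a^'n^'n. D ** D = 0 \<and> col_rank D = k})"
  let ?N = "\<lambda>k. real (adapted_count ?q ?n k)"
  let ?GL = "real (\<Prod>i<?n. ?q ^ ?n - ?q ^ i)"
  have q: "2 \<le> ?q" by (rule card_UNIV_field_ge_2)
  have n: "?n = 2 * m + 2 * s" using assms(3) r by simp
  have "?C k * ?N k = ?GL" if "2 * k \<le> ?n" for k
    using card_sq_zero_col_rank_mult_adapted_count[OF that, where 'a = 'a] by (simp flip: of_nat_mult)
  then have GL_m: "?C m * ?N m = ?GL" and GL_ms: "?C (m + s) * ?N (m + s) = ?GL" using n by simp_all
  have "0 < (\<Prod>i<?n. ?q ^ ?n - ?q ^ i)" using q by (intro prod_pos) (simp add: power_strict_increasing)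
  then have "?GL \<noteq> 0" by (metis of_nat_0_less_iff less_irrefl)
  then have "?C m / ?C (m + s) = ?N (m + s) / ?N m"
    by (rule divide_eq_divide_if_mult_eq[OF GL_m GL_ms])
  also have "\<dots> = ratio_formula (real ?q) m r"
    using q n r by (simp add: adapted_count_ratio ratio_formula_even)
  finally have "?C m / ?C (m + s) = ratio_formula (real ?q) m r" .
  moreover have "c_hom T r = card {D :: 'a^'n^'n. D ** D = 0 \<and> col_rank D = m}"
    by (rule c_hom_eq_card_col_rank) (simp add: n r)
  moreover have "c_hom T 0 = card {D :: 'a^'n^'n. D ** D = 0 \<and> col_rank D = m + s}"
    by (rule c_hom_eq_card_col_rank) (simp add: n)
  ultimately have "real (c_hom T r) / real (c_hom T 0) = ratio_formula (real ?q) m r" by simp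
  then show ?thesis using ratio_p_hom_eq_ratio_c_hom[of T r 0] ratio_formula_asymp_equiv[OF assms(1)] by simp
qed

end
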